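(* For all integers $n\geq 1$ and $k\geq 1$ we have $S_{n,k}(0)=S_{n,k}(1)=0$, and when at least one of $k$ and $n$ is odd, then $S_{n,k}(\tfrac{1}{2})=0$.
   Context: The Bernoulli polynomials $B_k(z)$ are defined by $\frac{xe^{zx}}{e^x-1}=\sum_{k=0}^\infty B_k(z)\frac{x^k}{k!}$, $|x|<2\pi$. For integers $n\geq 1$ and $k\geq 0$ define the polynomial \[ S_{n,k}(z):=\sum_{m=1}^n\binom{n+1}{m}(k!)^{n-m}(-1)^{km}\sum_{\substack{j_1,\ldots,j_m\geq 0\\ j_1+\dots+j_m=(k+1)(n-m)+k}}\ \prod_{i=1}^m\frac{B_{k+1+j_i}(z)}{j_i!\,(k+1+j_i)}, \] where the $j_i$ are integers. *)

theory Defs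
  imports "HOL-Complex_Analysis.Complex_Analysis"
begin

definition bernpoly :: "nat \<Rightarrow> complex \<Rightarrow> complex" where
  "bernpoly k z = fact k * fps_nth (fps_X * fps_exp z / (fps_exp 1 - 1)) k"

text \<open>The generating function, read as an identity of analytic functions on the disc
  of radius \<open>2 * pi\<close>; the singularity at \<open>0\<close> is removable with value \<open>1\<close>.\<close>

lemma bernpoly_sums:
  assumes "norm x < 2 * pi"
  shows "(\<lambda>k. bernpoly k z * (x ^ k / fact k)) sums
           (if x = 0 then 1 else x * exp (z * x) / (exp x - 1))"
proof -
  define G :: "complex fps" where "G = fps_exp 1 - 1"
  define f :: "complex \<Rightarrow> complex" where
    "f = (\<lambda>x. if x = 0 then 1 else x * exp (z * x) / (exp x - 1))"
  have G0: "G \<noteq> 0"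
  proof
    assume "G = 0"
    hence "fps_nth G 1 = 0" by simp
    thus False by (simp add: G_def)
  qed
  have sdG: "subdegree G = 1"
    by (rule subdegreeI) (auto simp: G_def)
  have sdF: "subdegree (fps_X * fps_exp z) = 1"
    by (rule subdegreeI) auto
  have exp_ne: "exp y \<noteq> 1" if "norm y < 2 * pi" "y \<noteq> 0" for y :: complex
  proof
    assume "exp y = 1"
    then obtain n :: int where n: "Re y = 0" "Im y = of_int (2 * n) * pi"
      by (auto simp: exp_eq_1)
    have "\<bar>Im y\<bar> < 2 * pi" using abs_Im_le_cmod[of y] that by linarith
    hence "\<bar>real_of_int n\<bar> < 1" using n by (simp add: abs_mult)
    hence "n = 0" by linarith
    thus False using n that by (simp add: complex_eq_iff)
  qed
  have lead: "fps_nth (fps_X * fps_exp z) 1 / fps_nth G 1 = 1"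
    by (simp add: G_def)
  have exp1: "f has_fps_expansion (fps_X * fps_exp z / G)"
  proof -
    have A: "(\<lambda>x. x * exp (z * x)) has_fps_expansion (fps_X * fps_exp z)"
      by (intro fps_expansion_intros)
    have "(\<lambda>x. exp (1 * x) - 1) has_fps_expansion G"
      unfolding G_def by (intro fps_expansion_intros)
    hence B: "(\<lambda>x. exp x - 1) has_fps_expansion G" by simp
    show ?thesis unfolding f_def
      by (rule has_fps_expansion_divide[OF A B]) (use lead in \<open>auto simp: sdG sdF G0\<close>)
  qed
  have an0: "f analytic_on {0}"
    using exp1 by (rule has_fps_expansion_imp_analytic_0)
  have hol: "f holomorphic_on ball 0 (2 * pi)"
  proof -
    have "f holomorphic_on ball 0 (2 * pi) - {0}"
    proof (rule holomorphic_transform)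
      show "(\<lambda>x. x * exp (z * x) / (exp x - 1)) holomorphic_on ball 0 (2 * pi) - {0}"
        by (intro holomorphic_intros) (use exp_ne in auto)
    qed (auto simp: f_def)
    hence "f analytic_on ball 0 (2 * pi) - {0}"
      by (subst analytic_on_open) auto
    with an0 have "f analytic_on ({0} \<union> (ball 0 (2 * pi) - {0}))"
      unfolding analytic_on_Un by blast
    thus ?thesis
      by (rule holomorphic_on_subset[OF analytic_imp_holomorphic]) auto
  qed
  have "(\<lambda>k. fps_nth (fps_X * fps_exp z / G) k * x ^ k) sums f x"
    using exp1 hol assms
    by (intro has_fps_expansion_imp_sums_complex[where r = "ereal (2 * pi)"]) auto
  thus ?thesis by (simp add: bernpoly_def G_def f_def)
qed

lemma bernpoly_altdef:
  "bernpoly k z = (\<Sum>i\<le>k. of_nat (k choose i) * bernpoly (k - i) 0 * z ^ i)"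
proof -
  define G :: "complex fps" where "G = fps_exp 1 - 1"
  have "fps_nth G 1 \<noteq> 0" by (simp add: G_def)
  hence G0: "G \<noteq> 0" by (metis fps_zero_nth)
  have sdG: "subdegree G = 1"
    by (rule subdegreeI) (auto simp: G_def)
  have "G dvd fps_X"
    using G0 by (subst fps_dvd_iff) (auto simp: sdG)
  hence "fps_X * fps_exp z / G = fps_exp z * (fps_X / G)"
    by (metis div_mult_swap mult.commute)
  hence "bernpoly k z = fact k * (\<Sum>i\<le>k. z ^ i / fact i * fps_nth (fps_X / G) (k - i))"
    by (simp add: bernpoly_def G_def fps_mult_nth atLeast0AtMost)
  also have "\<dots> = (\<Sum>i\<le>k. of_nat (k choose i) * bernpoly (k - i) 0 * z ^ i)"
    unfolding sum_distrib_left
    by (intro sum.cong) (auto simp: bernpoly_def G_def binomial_fact field_simps)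
  finally show ?thesis .
qed

text \<open>\<open>natpermute N m\<close> is the set of lists of \<open>m\<close> naturals with sum \<open>N\<close>, here standing for
  the tuples \<open>(j\<^sub>1, \<dots>, j\<^sub>m)\<close>, so \<open>js ! i\<close> is \<open>j\<^sub>i\<^sub>+\<^sub>1\<close>. As \<open>m \<le> n\<close> in the
  outer sum, the natural-number subtraction \<open>n - m\<close> does not truncate.\<close>

definition S :: "nat \<Rightarrow> nat \<Rightarrow> complex \<Rightarrow> complex" where
  "S n k z =
     (\<Sum>m=1..n. of_nat ((n + 1) choose m) * fact k ^ (n - m) * (-1) ^ (k * m) *
        (\<Sum>js\<in>natpermute ((k + 1) * (n - m) + k) m.
           \<Prod>i<m. bernpoly (k + 1 + js ! i) z / (fact (js ! i) * of_nat (k + 1 + js ! i))))"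

end

theory Submission
  imports Defs
begin

text \<open>
  Write \<open>K = exp (z x) / (exp x - 1)\<close>, a Laurent series in \<open>x\<close> with a simple pole at \<open>0\<close>. Its
  \<open>k\<close>-th derivative consists of the polar part \<open>(-1)^k k! / x^(k+1)\<close> and of the power series \<open>F\<close>
  with coefficients \<open>bernpoly (k+1+j) z / (j! (k+1+j))\<close>, which are the factors in the
  definition of \<open>S\<close>. Expanding the \<open>(n+1)\<close>-st power of this derivative \<open>D\<^sup>k K\<close> by the binomial
  theorem and reading off the coefficient of \<open>1/x\<close> gives

    residue of \<open>(D\<^sup>k K)^(n+1) = (-1)^(k (n+1)) k! S n k z\<close>

  (lemma \<open>fls_residue_bern_kernel_power\<close>), so the zeros of \<open>S\<close> are vanishing residues.

  At \<open>z = 0\<close> the kernel \<open>u = 1 / (exp x - 1)\<close> satisfies the autonomous equation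
  \<open>u' = -(u + u\<^sup>2)\<close>. Hence each derivative \<open>D\<^sup>k u\<close> with \<open>k \<ge> 1\<close>, and each positive power of
  it, is a polynomial in \<open>u\<close> with constant coefficients times \<open>u'\<close>. Such a product is the
  derivative of a polynomial in \<open>u\<close>, and derivatives have residue \<open>0\<close>
  (lemma \<open>fls_residue_deriv_power_autonomous\<close>). At \<open>z = 1\<close> the kernel is \<open>1 + u\<close>, which has
  the same derivatives.

  At \<open>z = 1/2\<close> the kernel is \<open>1 / (2 sinh (x/2))\<close>, an odd function. Its \<open>k\<close>-th derivative has
  parity \<open>(-1)^(k+1)\<close>, and so has \<open>F\<close>. The coefficients of \<open>F^m\<close> that occur in \<open>S\<close> then have the
  wrong parity as soon as \<open>(k+1) n + k\<close> is odd, which happens when \<open>k\<close> or \<open>n\<close> is odd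
  (lemma \<open>fps_nth_power_eq_0_by_parity\<close>).
\<close>

section \<open>The Bernoulli kernel and its derivatives\<close>

definition bern_kernel :: "complex \<Rightarrow> complex fls" where
  "bern_kernel z = fps_to_fls (fps_exp z) / fps_to_fls (fps_exp 1 - 1)"

text \<open>
  This is the \<open>k\<close>-th derivative of the regular part of \<^const>\<open>bern_kernel\<close>, given by its
  coefficients because these are the factors in the definition of \<open>S\<close>.
\<close>

definition bern_regular :: "nat \<Rightarrow> complex \<Rightarrow> complex fps" where
  "bern_regular k z =
     Abs_fps (\<lambda>j. bernpoly (k + 1 + j) z / (fact j * of_nat (k + 1 + j)))"

lemma exp_minus_one_nonzero: "fps_exp 1 - 1 \<noteq> (0 :: complex fps)"
proof
  assume "fps_exp 1 - 1 = (0 :: complex fps)"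
  hence "fps_nth (fps_exp 1 - 1 :: complex fps) 1 = 0" by simp
  thus False by simp
qed

lemma subdegree_exp_minus_one: "subdegree (fps_exp 1 - 1 :: complex fps) = 1"
  by (rule subdegreeI) auto

lemma bernpoly_fps_mult:
  "Abs_fps (\<lambda>k. bernpoly k z / fact k) * (fps_exp 1 - 1) = fps_X * fps_exp z"
proof -
  have "subdegree (fps_X * fps_exp z :: complex fps) = 1"
    by (rule subdegreeI) auto
  hence "(fps_exp 1 - 1) dvd (fps_X * fps_exp z :: complex fps)"
    using exp_minus_one_nonzero subdegree_exp_minus_one by (subst fps_dvd_iff) auto
  moreover have "Abs_fps (\<lambda>k. bernpoly k z / fact k) = fps_X * fps_exp z / (fps_exp 1 - 1)"
    by (rule fps_ext) (simp add: bernpoly_def)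
  ultimately show ?thesis by simp
qed

lemma bernpoly_0: "bernpoly 0 z = 1"
proof -
  have "fps_nth (Abs_fps (\<lambda>k. bernpoly k z / fact k) * (fps_exp 1 - 1)) 1
          = fps_nth (fps_X * fps_exp z) 1"
    by (simp only: bernpoly_fps_mult)
  thus ?thesis by (simp add: fps_mult_nth)
qed

text \<open>
  The \<open>j\<close>-th coefficient of the regular part is \<open>bernpoly (j+1) z / (j+1)!\<close>, which is the value of
  \<^const>\<open>bern_regular\<close> at \<open>k = 0\<close>. The simple pole comes from \<open>bernpoly 0 z = 1\<close>.
\<close>

lemma bern_kernel_decomp: "bern_kernel z = fps_to_fls (bern_regular 0 z) + fls_X_inv"
proof -
  define B where "B = Abs_fps (\<lambda>k. bernpoly k z / fact k)"
  have "fps_to_fls B * fps_to_fls (fps_exp 1 - 1) = fls_X * fps_to_fls (fps_exp z)"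
    unfolding B_def
    by (simp only: fls_times_fps_to_fls[symmetric] bernpoly_fps_mult fps_X_to_fls[symmetric])
  hence B_eq: "fps_to_fls B = fls_X * bern_kernel z"
    using exp_minus_one_nonzero by (simp add: bern_kernel_def field_simps del: fps_to_fls_minus)
  have "B = fps_X * bern_regular 0 z + 1"
    by (rule fps_ext) (auto simp: B_def bern_regular_def bernpoly_0 fact_reduce)
  hence "fps_to_fls B = fls_X * (fps_to_fls (bern_regular 0 z) + fls_X_inv)"
    by (simp add: fls_times_fps_to_fls distrib_left fls_X_times_conv_shift fls_X_inv_times_conv_shift)
  thus ?thesis using B_eq by simp
qed

lemma fps_deriv_bern_regular: "fps_deriv (bern_regular k z) = bern_regular (Suc k) z"
  by (rule fps_ext) (simp add: bern_regular_def field_simps del: of_nat_Suc)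

lemma fls_deriv_funpow_bern_kernel:
  "(fls_deriv ^^ k) (bern_kernel z) =
     fps_to_fls (bern_regular k z) + fls_const ((-1) ^ k * fact k) * fls_X_inv ^ (k + 1)"
proof (induction k)
  case 0
  show ?case by (simp add: bern_kernel_decomp)
next
  case (Suc k)
  have "fls_deriv (fls_const ((-1) ^ k * fact k) * fls_X_inv ^ (k + 1) :: complex fls)
          = fls_const ((-1) ^ Suc k * fact (Suc k)) * fls_X_inv ^ (Suc k + 1)"
  proof (rule fls_eqI)
    fix i :: int
    show "fls_nth (fls_deriv (fls_const ((-1) ^ k * fact k) * fls_X_inv ^ (k + 1) :: complex fls)) i
            = fls_nth (fls_const ((-1) ^ Suc k * fact (Suc k)) * fls_X_inv ^ (Suc k + 1)) i"
    proof (cases "i = - int k - 2")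
      case True
      thus ?thesis by (simp del: power_Suc) (simp add: algebra_simps)
    next
      case False
      thus ?thesis by (simp del: power_Suc)
    qed
  qed
  thus ?case using Suc
    by (simp add: fls_deriv_fps_to_fls fps_deriv_bern_regular)
qed

section \<open>The residue formula\<close>

lemma fls_residue_power_polar:
  fixes f :: "complex fps"
  assumes "n \<ge> 1"
  shows "fls_residue ((fps_to_fls f + fls_const c * fls_X_inv ^ (k + 1)) ^ (n + 1)) =
           (\<Sum>m=1..n. of_nat ((n + 1) choose m) * c ^ (n + 1 - m) *
              fps_nth (f ^ m) ((k + 1) * (n - m) + k))"
proof -
  define t where "t = (\<lambda>m. of_nat ((n + 1) choose m) * fps_to_fls f ^ m *
                          (fls_const c * fls_X_inv ^ (k + 1)) ^ (n + 1 - m))"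
  have t_coeff: "fls_nth (t m) (-1) = of_nat ((n + 1) choose m) * c ^ (n + 1 - m) *
      fls_nth (fps_to_fls (f ^ m)) (int ((k + 1) * (n + 1 - m)) - 1)" for m
  proof -
    have "t m = fls_const (of_nat ((n + 1) choose m) * c ^ (n + 1 - m)) *
                  (fls_X_inv ^ ((k + 1) * (n + 1 - m)) * fps_to_fls (f ^ m))"
      by (simp add: t_def power_mult_distrib fps_to_fls_power fls_of_nat fls_const_power
            power_mult power_add mult_ac flip: fls_const_mult_const)
    thus ?thesis
      by (simp add: fls_X_inv_power_times_conv_shift)
  qed
  \<comment> \<open>For \<open>n \<ge> 1\<close> the purely polar term \<open>c^(n+1) / x^((k+1)(n+1))\<close> has a pole of order at
    least \<open>2\<close>, hence no residue.\<close>
  have t_zero: "fls_nth (t 0) (-1) = 0"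
  proof -
    have "int ((k + 1) * (n + 1)) - 1 = int ((k + 1) * n + k)"
      by (simp add: algebra_simps)
    thus ?thesis
      using assms unfolding t_coeff by (simp del: of_nat_add of_nat_mult)
  qed
  have t_last: "fls_nth (t (n + 1)) (-1) = 0"
    unfolding t_coeff by simp
  have t_mid: "fls_nth (t m) (-1) = of_nat ((n + 1) choose m) * c ^ (n + 1 - m) *
              fps_nth (f ^ m) ((k + 1) * (n - m) + k)" if "m \<in> {1..n}" for m
  proof -
    have "int ((k + 1) * (n + 1 - m)) - 1 = int ((k + 1) * (n - m) + k)"
      using that by (simp add: Suc_diff_le)
    hence "fls_nth (fps_to_fls (f ^ m)) (int ((k + 1) * (n + 1 - m)) - 1) =
             fls_nth (fps_to_fls (f ^ m)) (int ((k + 1) * (n - m) + k))"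
      by (simp only:)
    also have "\<dots> = fps_nth (f ^ m) ((k + 1) * (n - m) + k)"
      unfolding fps_to_fls_nth by (simp only: nat_int of_nat_less_0_iff if_False)
    finally show ?thesis unfolding t_coeff by (simp only:)
  qed
  have "(fps_to_fls f + fls_const c * fls_X_inv ^ (k + 1)) ^ (n + 1) = (\<Sum>m\<le>n+1. t m)"
    unfolding t_def by (rule binomial_ring)
  hence "fls_residue ((fps_to_fls f + fls_const c * fls_X_inv ^ (k + 1)) ^ (n + 1))
           = (\<Sum>m\<le>n+1. fls_nth (t m) (-1))"
    by (simp only: fls_residue_def fls_nth_sum)
  also have "\<dots> = (\<Sum>m=1..n. fls_nth (t m) (-1))"
    by (rule sum.mono_neutral_right) (use t_zero t_last in \<open>auto simp: not_le less_Suc_eq le_Suc_eq\<close>)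
  also have "\<dots> = (\<Sum>m=1..n. of_nat ((n + 1) choose m) * c ^ (n + 1 - m) *
              fps_nth (f ^ m) ((k + 1) * (n - m) + k))"
    by (rule sum.cong[OF refl t_mid])
  finally show ?thesis .
qed

text \<open>
  A sum over the tuples with a prescribed sum is a coefficient of a power of a power series.
\<close>

lemma S_eq_sum_coeffs:
  "S n k z = (\<Sum>m=1..n. of_nat ((n + 1) choose m) * fact k ^ (n - m) * (-1) ^ (k * m) *
                fps_nth (bern_regular k z ^ m) ((k + 1) * (n - m) + k))"
  unfolding S_def
proof (rule sum.cong[OF refl])
  fix m assume "m \<in> {1..n}"
  then obtain m' where m: "m = Suc m'" by (cases m) auto
  have "fps_nth (bern_regular k z ^ m) ((k + 1) * (n - m) + k) =
          (\<Sum>js\<in>natpermute ((k + 1) * (n - m) + k) m.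
             \<Prod>i<m. bernpoly (k + 1 + js ! i) z / (fact (js ! i) * of_nat (k + 1 + js ! i)))"
    unfolding m fps_power_nth_Suc
    by (simp add: bern_regular_def lessThan_Suc_atMost atLeast0AtMost)
  thus "of_nat ((n + 1) choose m) * fact k ^ (n - m) * (-1) ^ (k * m) *
          (\<Sum>js\<in>natpermute ((k + 1) * (n - m) + k) m.
             \<Prod>i<m. bernpoly (k + 1 + js ! i) z / (fact (js ! i) * of_nat (k + 1 + js ! i))) =
        of_nat ((n + 1) choose m) * fact k ^ (n - m) * (-1) ^ (k * m) *
          fps_nth (bern_regular k z ^ m) ((k + 1) * (n - m) + k)"
    by simp
qed

lemma fls_residue_bern_kernel_power:
  assumes "n \<ge> 1"
  shows "fls_residue ((fls_deriv ^^ k) (bern_kernel z) ^ (n + 1)) =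
     (-1) ^ (k * (n + 1)) * fact k * S n k z"
proof -
  \<comment> \<open>The sign of the polar part, \<open>(-1)^k\<close> to the power \<open>n + 1 - m\<close>, is \<open>(-1)^(k m)\<close> up to a sign
    that does not depend on \<open>m\<close>; one factor \<open>k!\<close> is left over as well.\<close>
  have factor: "((-1) ^ k * fact k) ^ (n + 1 - m) =
                  (-1) ^ (k * (n + 1)) * fact k * (fact k ^ (n - m) * (-1) ^ (k * m) :: complex)"
    if "m \<in> {1..n}" for m
  proof -
    have "n + 1 - m = Suc (n - m)" using that by auto
    hence "fact k ^ (n + 1 - m) = (fact k * fact k ^ (n - m) :: complex)" by simp
    moreover have "(-1 :: complex) ^ (k * (n + 1 - m)) = (-1) ^ (k * (n + 1)) * (-1) ^ (k * m)"
    proof -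
      have "k * (n + 1) = k * (n + 1 - m) + k * m"
        using that by (simp flip: distrib_left)
      thus ?thesis by (simp only: power_add mult.assoc power_mult_distrib[symmetric]) simp
    qed
    ultimately show ?thesis
      by (simp only: power_mult_distrib power_mult[symmetric] mult_ac)
  qed
  show ?thesis
    unfolding fls_deriv_funpow_bern_kernel fls_residue_power_polar[OF assms] S_eq_sum_coeffs sum_distrib_left
    by (rule sum.cong[OF refl], subst factor) (simp_all only: mult_ac)
qed

section \<open>Polynomials in a Laurent series\<close>

text \<open>
  The coefficients are Laurent series with derivative \<open>0\<close> rather than complex numbers, so that
  evaluation at a Laurent series is the usual \<^const>\<open>poly\<close>.
\<close>

definition constant_coeffs :: "complex fls poly \<Rightarrow> bool" where
  "constant_coeffs p \<longleftrightarrow> (\<forall>i. fls_deriv (coeff p i) = 0)"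

lemma constant_coeffs_mult:
  "constant_coeffs p \<Longrightarrow> constant_coeffs q \<Longrightarrow> constant_coeffs (p * q)"
  by (simp add: constant_coeffs_def coeff_mult fls_deriv_sum)

lemma constant_coeffs_add:
  "constant_coeffs p \<Longrightarrow> constant_coeffs q \<Longrightarrow> constant_coeffs (p + q)"
  by (simp add: constant_coeffs_def)

lemma constant_coeffs_power: "constant_coeffs p \<Longrightarrow> constant_coeffs (p ^ n)"
  by (induction n) (auto simp: constant_coeffs_mult, simp add: constant_coeffs_def coeff_1)

lemma constant_coeffs_pderiv: "constant_coeffs p \<Longrightarrow> constant_coeffs (pderiv p)"
  by (simp add: constant_coeffs_def coeff_pderiv fls_of_nat del: of_nat_Suc)

lemma fls_deriv_poly:
  assumes "constant_coeffs p"
  shows "fls_deriv (poly p u) = poly (pderiv p) u * fls_deriv u"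
  using assms
proof (induction p)
  case 0
  show ?case by simp
next
  case (pCons a p)
  have "fls_deriv a = 0" "constant_coeffs p"
    using pCons.prems by (auto simp: constant_coeffs_def coeff_pCons split: nat.splits)
  thus ?case using pCons.IH by (simp add: pderiv_pCons algebra_simps)
qed

text \<open>
  The series is the derivative of the polynomial with coefficients \<open>coeff p i / (i+1)\<close>
  in \<open>u ^ (i+1)\<close>.
\<close>

lemma fls_residue_poly_times_deriv:
  assumes "constant_coeffs p"
  shows "fls_residue (poly p u * fls_deriv u) = 0"
proof -
  have "poly p u * fls_deriv u = (\<Sum>i\<le>degree p. coeff p i * u ^ i * fls_deriv u)"
    by (simp add: poly_altdef sum_distrib_right)
  also have "\<dots> = (\<Sum>i\<le>degree p. fls_deriv (fls_const (1 / of_nat (Suc i)) * coeff p i * u ^ Suc i))"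
  proof (rule sum.cong[OF refl])
    fix i
    have "fls_const (1 / of_nat (Suc i)) * of_nat (Suc i) = (1 :: complex fls)"
      unfolding fls_of_nat fls_const_mult_const[symmetric] by (simp del: of_nat_Suc)
    moreover have "fls_deriv (coeff p i) = 0"
      using assms by (simp add: constant_coeffs_def)
    ultimately show "coeff p i * u ^ i * fls_deriv u =
        fls_deriv (fls_const (1 / of_nat (Suc i)) * coeff p i * u ^ Suc i)"
      by (simp add: fls_deriv_power mult_ac del: of_nat_Suc power_Suc)
  qed
  also have "\<dots> = fls_deriv (\<Sum>i\<le>degree p. fls_const (1 / of_nat (Suc i)) * coeff p i * u ^ Suc i)"
    by (rule fls_deriv_sum[symmetric])
  finally show ?thesis by (simp only: fls_residue_deriv)
qed

text \<open>
  The equation makes all higher derivatives of \<open>u\<close> polynomials in \<open>u\<close>, and the factor \<open>u'\<close>, once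
  present, survives each further differentiation. One such factor is all that is needed to
  integrate the power.
\<close>

lemma fls_residue_deriv_power_autonomous:
  assumes ode: "fls_deriv u = poly q u" and q: "constant_coeffs q" and "k \<ge> 1"
  shows "fls_residue ((fls_deriv ^^ k) u ^ (n + 1)) = 0"
proof -
  from \<open>k \<ge> 1\<close> have "\<exists>p. constant_coeffs p \<and> (fls_deriv ^^ k) u = poly p u * fls_deriv u"
  proof (induction k rule: dec_induct)
    case base
    show ?case by (intro exI[of _ 1]) (simp add: constant_coeffs_def coeff_1)
  next
    case (step k)
    then obtain p where p: "constant_coeffs p" "(fls_deriv ^^ k) u = poly p u * fls_deriv u"
      by blast
    have "(fls_deriv ^^ Suc k) u = fls_deriv (poly p u * poly q u)"
      using p(2) ode by simp
    also have "\<dots> = poly (pderiv p * q + p * pderiv q) u * fls_deriv u"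
      using fls_deriv_poly[OF p(1)] fls_deriv_poly[OF q] by (simp add: algebra_simps)
    finally show ?case
      using p(1) q
      by (metis constant_coeffs_add constant_coeffs_mult constant_coeffs_pderiv)
  qed
  then obtain p where p: "constant_coeffs p" "(fls_deriv ^^ k) u = poly p u * fls_deriv u"
    by blast
  have "(fls_deriv ^^ k) u ^ (n + 1) = poly (p ^ (n + 1) * q ^ n) u * fls_deriv u"
    unfolding p(2) power_mult_distrib using ode by (simp add: mult_ac)
  moreover have "constant_coeffs (p ^ (n + 1) * q ^ n)"
    by (intro constant_coeffs_mult constant_coeffs_power p(1) q)
  ultimately show ?thesis
    by (simp only: fls_residue_poly_times_deriv)
qed

section \<open>The points 0 and 1\<close>

lemma bern_kernel_0_ode:
  "fls_deriv (bern_kernel 0) = poly [:0, -1, -1:] (bern_kernel 0)"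
proof -
  define E :: "complex fls" where "E = fps_to_fls (fps_exp 1)"
  have E': "fls_deriv E = E"
    by (simp add: E_def fls_deriv_fps_to_fls)
  have nz: "E - 1 \<noteq> 0"
    using exp_minus_one_nonzero fps_to_fls_nonzeroI by (fastforce simp: E_def)
  have U: "bern_kernel 0 = inverse (E - 1)"
    by (simp add: bern_kernel_def E_def inverse_eq_divide)
  have "fls_deriv (inverse (E - 1)) = - E * (inverse (E - 1))\<^sup>2"
    by (subst fls_inverse_deriv) (simp_all add: E')
  also have "\<dots> = poly [:0, -1, -1:] (inverse (E - 1))"
    using nz by (simp add: field_simps power2_eq_square)
  finally show ?thesis by (simp only: U)
qed

lemma bern_kernel_1: "bern_kernel 1 = 1 + bern_kernel 0"
proof -
  define E :: "complex fls" where "E = fps_to_fls (fps_exp 1)"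
  have "E - 1 \<noteq> 0"
    using exp_minus_one_nonzero fps_to_fls_nonzeroI by (fastforce simp: E_def)
  thus ?thesis by (simp add: bern_kernel_def field_simps flip: E_def)
qed

lemma S_0_eq_0:
  assumes "n \<ge> 1" and "k \<ge> 1"
  shows "S n k 0 = 0"
proof -
  have "constant_coeffs [:0, -1, -1:]"
    by (auto simp: constant_coeffs_def coeff_pCons split: nat.splits)
  hence "fls_residue ((fls_deriv ^^ k) (bern_kernel 0) ^ (n + 1)) = 0"
    using fls_residue_deriv_power_autonomous bern_kernel_0_ode \<open>k \<ge> 1\<close> by blast
  thus ?thesis
    unfolding fls_residue_bern_kernel_power[OF \<open>n \<ge> 1\<close>] by simp
qed

lemma S_1_eq_S_0:
  assumes "n \<ge> 1" and "k \<ge> 1"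
  shows "S n k 1 = S n k 0"
proof -
  have "(fls_deriv ^^ k) (bern_kernel 1) = (fls_deriv ^^ k) (bern_kernel 0)"
    using \<open>k \<ge> 1\<close> by (cases k) (simp_all add: bern_kernel_1 funpow_Suc_right del: funpow.simps)
  hence "(-1) ^ (k * (n + 1)) * fact k * S n k 1 = (-1) ^ (k * (n + 1)) * fact k * S n k 0"
    by (simp only: fls_residue_bern_kernel_power[OF \<open>n \<ge> 1\<close>, symmetric])
  thus ?thesis by simp
qed

section \<open>The point 1/2\<close>

text \<open>
  The series \<open>x exp (x/2) / (exp x - 1)\<close> is even: substituting \<open>-x\<close> and then multiplying numerator
  and denominator by \<open>exp x\<close> gives the same quotient.
\<close>

lemma bernpoly_half_odd:
  assumes "odd r"
  shows "bernpoly r (1 / 2) = 0"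
proof -
  define B :: "complex fps" where "B = Abs_fps (\<lambda>k. bernpoly k (1 / 2) / fact k)"
  define C where "C = fps_compose B (- fps_X)"
  have exp_cancel: "fps_exp 1 * fps_exp (-1) = (1 :: complex fps)"
    and exp_half: "fps_exp 1 * fps_exp (- (1 / 2)) = (fps_exp (1 / 2) :: complex fps)"
    by (simp_all flip: fps_exp_add_mult)
  have B_eq: "B * (fps_exp 1 - 1) = fps_X * fps_exp (1 / 2)"
    unfolding B_def by (rule bernpoly_fps_mult)
  hence "fps_compose (B * (fps_exp 1 - 1)) (- fps_X) = fps_compose (fps_X * fps_exp (1 / 2)) (- fps_X)"
    by simp
  hence "C * (fps_exp (-1) - 1) = - fps_X * fps_exp (- (1 / 2))"
    by (simp add: fps_compose_mult_distrib fps_compose_sub_distrib C_def)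
  hence "C * (fps_exp 1 * fps_exp (-1) - fps_exp 1) = - fps_X * (fps_exp 1 * fps_exp (- (1 / 2)))"
    by (metis (no_types, opaque_lifting) mult.left_commute mult.right_neutral right_diff_distrib)
  hence "C * (fps_exp 1 - 1) = B * (fps_exp 1 - 1)"
    unfolding exp_cancel exp_half B_eq by (simp add: algebra_simps)
  hence "C = B" using exp_minus_one_nonzero by simp
  hence "fps_nth C r = fps_nth B r" by simp
  hence "- fps_nth B r = fps_nth B r"
    using assms by (simp add: C_def fps_compose_uminus')
  thus ?thesis by (simp add: B_def)
qed

text \<open>
  The hypothesis says that \<open>f(-x) = (-1)^d f(x)\<close>, so \<open>f^m\<close> has the sign \<open>(-1)^(d m)\<close>, and its
  coefficients of the other parity vanish.
\<close>

lemma fps_nth_power_eq_0_by_parity: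
  fixes f :: "complex fps"
  assumes parity: "\<And>j. odd (d + j) \<Longrightarrow> fps_nth f j = 0" and odd: "odd (d * m + i)"
  shows "fps_nth (f ^ m) i = 0"
proof -
  have "fps_compose f (- fps_X) = fps_const ((-1) ^ d) * f"
  proof (rule fps_ext)
    fix j
    show "fps_nth (fps_compose f (- fps_X)) j = fps_nth (fps_const ((-1) ^ d) * f) j"
      using parity[of j] by (cases "odd (d + j)") (auto simp: fps_compose_uminus' minus_one_power_iff)
  qed
  hence "fps_compose (f ^ m) (- fps_X) = fps_const ((-1) ^ (d * m)) * f ^ m"
    by (simp add: power_mult_distrib power_mult flip: fps_compose_power)
  hence "(-1) ^ i * fps_nth (f ^ m) i = (-1) ^ (d * m) * fps_nth (f ^ m) i"
    by (simp add: fps_eq_iff fps_compose_uminus')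
  moreover have "(-1 :: complex) ^ i = - ((-1) ^ (d * m))"
    using odd by (auto simp: minus_one_power_iff)
  ultimately show ?thesis by simp
qed

lemma S_half_eq_0:
  assumes "odd k \<or> odd n"
  shows "S n k (1 / 2) = 0"
proof -
  have "fps_nth (bern_regular k (1 / 2) ^ m) ((k + 1) * (n - m) + k) = 0" if "m \<in> {1..n}" for m
  proof (rule fps_nth_power_eq_0_by_parity)
    show "fps_nth (bern_regular k (1 / 2)) j = 0" if "odd (k + 1 + j)" for j
      using bernpoly_half_odd[OF that] by (simp add: bern_regular_def)
    \<comment> \<open>The parity that matters does not depend on \<open>m\<close>.\<close>
    have "(k + 1) * m + ((k + 1) * (n - m) + k) = (k + 1) * n + k"
      using that by (simp flip: add.assoc distrib_left)
    moreover have "odd ((k + 1) * n + k)"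
      using assms by auto
    ultimately show "odd ((k + 1) * m + ((k + 1) * (n - m) + k))"
      by metis
  qed
  thus ?thesis by (simp add: S_eq_sum_coeffs)
qed

theorem corollary2:
  fixes n k :: nat
  assumes "n \<ge> 1" and "k \<ge> 1"
  shows "S n k 0 = 0 \<and> S n k 1 = 0 \<and> (odd k \<or> odd n \<longrightarrow> S n k (1 / 2) = 0)"
  using S_0_eq_0 S_1_eq_S_0 S_half_eq_0 assms by simp

end
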